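(* Let $B^d = \{x \in \mathbb{R}^d \mid \|x\| \le 1\}$ be the unit ball centered at the origin, and let $p_1, \ldots, p_n \in B^d$ be pairwise distinct points, $n \ge 3$. Then there exists a projective transformation $\phi$ of $\mathbb{R}\mathrm{P}^d$ with $\phi(B^d) = B^d$ such that \[ \sum_{i=1}^n \phi(p_i) = 0. \] The transformation $\phi$ is unique up to post-composition with an orthogonal transformation of $\mathbb{R}^d$.
   Context: $\mathbb{R}^d$ is identified with the affine chart $\{(x_0 : x_1 : \cdots : x_d) \mid x_0 \neq 0\}$ of $\mathbb{R}\mathrm{P}^d$. *)

theory Defs
  imports "HOL-Analysis.Analysis"
begin

text \<open>
  The type \<open>'d RP\<close> is the real projective space of dimension \<open>CARD('d)\<close>.
  Homogeneous coordinates are indexed by \<open>'d option\<close>: the index \<open>None\<close> plays the role of \<open>0\<close>,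
  and \<open>Some i\<close>, for \<open>i :: 'd\<close>, are the remaining indices.
\<close>

typedef (overloaded) ('d::finite) RP = "{L :: (real ^ ('d option)) set. subspace L \<and> dim L = 1}"
  morphisms line_of RP_of_line
proof -
  have "dim (span {axis None 1 :: real ^ ('d option)}) = 1"
    by (simp add: dim_span_eq_card_independent axis_eq_0_iff)
  then show ?thesis
    using subspace_span by blast
qed

definition homogenize :: "real ^ 'd \<Rightarrow> real ^ ('d::finite option)"
  where "homogenize x = (\<chi> i. case i of None \<Rightarrow> 1 | Some j \<Rightarrow> x $ j)"

definition chart :: "real ^ 'd \<Rightarrow> ('d::finite) RP"
  where "chart x = RP_of_line (span {homogenize x})"

text \<open>Only meaningful on the range of \<open>chart\<close>.\<close>

definition affine_coords :: "('d::finite) RP \<Rightarrow> real ^ 'd"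
  where "affine_coords = inv chart"

definition projective_transformation :: "(('d::finite) RP \<Rightarrow> 'd RP) \<Rightarrow> bool"
  where "projective_transformation \<phi> \<longleftrightarrow>
    (\<exists>f :: real ^ ('d option) \<Rightarrow> real ^ ('d option).
      linear f \<and> bij f \<and> (\<forall>P. line_of (\<phi> P) = f ` line_of P))"

text \<open>
  The projective transformations that extend an orthogonal transformation of the affine chart.
\<close>

definition orthogonal_projective_transformation :: "(('d::finite) RP \<Rightarrow> 'd RP) \<Rightarrow> bool"
  where "orthogonal_projective_transformation \<phi> \<longleftrightarrow>
    projective_transformation \<phi> \<and>
    (\<exists>A. orthogonal_transformation A \<and> (\<forall>x. \<phi> (chart x) = chart (A x)))"

definition centering_transformation ::
    "nat \<Rightarrow> (nat \<Rightarrow> real ^ 'd) \<Rightarrow> (('d::finite) RP \<Rightarrow> 'd RP) \<Rightarrow> bool"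
  where "centering_transformation n p \<phi> \<longleftrightarrow>
    projective_transformation \<phi> \<and>
    \<phi> ` (chart ` cball 0 1) = chart ` cball 0 1 \<and>
    (\<Sum>i=1..n. affine_coords (\<phi> (chart (p i)))) = 0"

text \<open>
  Sanity checks: \<open>chart\<close> identifies the affine space with the points whose homogeneous
  coordinate at \<open>None\<close> is nonzero, and \<open>affine_coords\<close> is its inverse.
\<close>

lemma homogenize_nth [simp]:
  "homogenize x $ None = 1" "homogenize x $ Some j = x $ j"
  by (simp_all add: homogenize_def)

lemma homogenize_nonzero [simp]: "homogenize x \<noteq> 0"
  by (metis homogenize_nth(1) zero_index zero_neq_one)

lemma line_of_chart: "line_of (chart x) = span {homogenize x}"
proof -
  have "dim (span {homogenize x}) = 1"
    by (simp add: dim_span_eq_card_independent)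
  then show ?thesis
    unfolding chart_def by (simp add: RP_of_line_inverse)
qed

lemma inj_chart: "inj (chart :: real ^ 'd \<Rightarrow> ('d::finite) RP)"
proof (rule injI)
  fix x y :: "real ^ 'd"
  assume "chart x = chart y"
  then have "span {homogenize x} = span {homogenize y}"
    by (metis line_of_chart)
  then have "homogenize x \<in> span {homogenize y}"
    by (metis insertI1 span_base)
  then obtain c where c: "homogenize x = c *\<^sub>R homogenize y"
    by (auto simp: span_singleton)
  have "c = 1"
    using arg_cong[OF c, of "\<lambda>v. v $ None"] by simp
  then have "homogenize x = homogenize y"
    using c by simp
  then have "x $ j = y $ j" for j
    by (metis homogenize_nth(2))
  then show "x = y"
    by (simp add: vec_eq_iff)
qed

lemma affine_coords_chart [simp]: "affine_coords (chart x) = x"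
  by (simp add: affine_coords_def inj_chart)

lemma range_chart:
  "range (chart :: real ^ 'd \<Rightarrow> ('d::finite) RP) = {P. \<exists>v \<in> line_of P. v $ None \<noteq> 0}"
proof (intro set_eqI iffI)
  fix P :: "'d RP"
  assume "P \<in> range chart"
  then obtain x where "P = chart x" by blast
  then have "homogenize x \<in> line_of P"
    by (simp add: line_of_chart span_base)
  moreover have "homogenize x $ None \<noteq> 0"
    by simp
  ultimately show "P \<in> {P. \<exists>v \<in> line_of P. v $ None \<noteq> 0}"
    by blast
next
  fix P :: "'d RP"
  assume "P \<in> {P. \<exists>v \<in> line_of P. v $ None \<noteq> 0}"
  then obtain v where v: "v \<in> line_of P" "v $ None \<noteq> 0" by blast
  define x :: "real ^ 'd" where "x = (\<chi> j. v $ Some j / v $ None)"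
  have L: "subspace (line_of P)" "dim (line_of P) = 1"
    using line_of[of P] by auto
  have "homogenize x = (1 / v $ None) *\<^sub>R v"
    using v(2) by (simp add: vec_eq_iff homogenize_def x_def split: option.split)
  then have "homogenize x \<in> line_of P"
    using L(1) v(1) by (simp add: subspace_scale)
  then have "span {homogenize x} \<subseteq> line_of P"
    using L(1) by (simp add: span_minimal)
  moreover have "dim (span {homogenize x}) = 1"
    by (simp add: dim_span_eq_card_independent)
  ultimately have "span {homogenize x} = line_of P"
    using L by (metis order_refl subspace_dim_equal subspace_span)
  then have "P = chart x"
    by (metis chart_def line_of_inverse)
  then show "P \<in> range chart" by blast
qed

end

theory Submission
  imports Defs
begin

text \<open>
  In homogeneous coordinates \<open>(v\<^sub>0, v')\<close> the unit ball is the projectivisation of the solid cone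
  \<open>v\<^sub>0\<^sup>2 - v' \<bullet> v' \<ge> 0\<close>. A projective transformation preserves the ball exactly when a linear map
  representing it preserves this cone, and then it multiplies the Lorentz form
  \<open>v\<^sub>0 w\<^sub>0 - v' \<bullet> w'\<close> by a positive constant (\<open>cone_preserving_conformal\<close>). The centering problem is
  therefore a problem about the Lorentz group acting on hyperbolic space.

  Existence. Let \<open>h\<^sub>i\<close> be the homogeneous vector \<open>(1, p\<^sub>i)\<close>, \<open>L\<close> a Lorentz transformation, and \<open>x\<close> the
  point of hyperbolic space that \<open>L\<close> sends to the time axis \<open>e = (1, 0)\<close>. The time component of
  \<open>L h\<^sub>i\<close> is the Lorentz product of \<open>h\<^sub>i\<close> and \<open>x\<close>, so the images of the \<open>p\<^sub>i\<close> have centroid \<open>0\<close> iff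
  \<open>\<Sum>h\<^sub>i / \<langle>h\<^sub>i, x\<rangle>\<close> is a multiple of \<open>x\<close>. This is the critical point equation of
  \<open>x \<mapsto> \<Sum>ln \<langle>h\<^sub>i, x\<rangle>\<close> on hyperbolic space. Writing \<open>x\<close> as a multiple of \<open>(1, y)\<close> with \<open>y\<close> in the open
  ball turns this function into \<open>centering_potential\<close>. It tends to infinity at the boundary:
  since the \<open>p\<^sub>i\<close> are distinct, near the boundary at most one of the factors \<open>1 - p\<^sub>i \<bullet> y\<close> is small,
  and three points are enough for the other term to win (\<open>centering_potential_coercive\<close>). Hence it
  has a minimiser \<open>y\<close> (\<open>exists_balance_point\<close>), and the Lorentz half-turn that exchanges the lines
  of \<open>(1, y)\<close> and \<open>e\<close> is a centering transformation.

  Uniqueness. The quotient of two centering transformations preserves the ball and keeps the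
  centroid of the image points \<open>q\<^sub>i\<close> at \<open>0\<close>. If it sends \<open>(1, y)\<close> to the time axis and \<open>y \<noteq> 0\<close>, it is a
  rotation after a hyperbolic translation along \<open>y\<close>, which moves every point of the ball strictly
  against \<open>y\<close>, apart from the two endpoints \<open>\<plusminus> y / \<parallel>y\<parallel>\<close> of the axis. As there are at least three
  points, the centroid would move (\<open>boost_displaces_centroid\<close>). So \<open>y = 0\<close>, and a
  Lorentz-conformal map that fixes the time axis is orthogonal on the affine chart
  (\<open>orthogonal_if_fixes_time_axis\<close>).
\<close>

section \<open>The Lorentz form in homogeneous coordinates\<close>

text \<open>
  As the Euclidean inner product on \<open>real ^ 'd option\<close> includes the product of the time components,
  this is \<open>v\<^sub>0 w\<^sub>0\<close> minus the inner product of the space components.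
\<close>

definition lorentz :: "real ^ ('d::finite option) \<Rightarrow> real ^ ('d option) \<Rightarrow> real"
  where "lorentz v w = 2 * (v $ None * w $ None) - v \<bullet> w"

lemma bilinear_lorentz: "bilinear lorentz"
  unfolding bilinear_def lorentz_def
  by (auto intro!: linearI simp: algebra_simps inner_add_left inner_add_right)

lemmas lorentz_simps =
  bilinear_ladd[OF bilinear_lorentz] bilinear_radd[OF bilinear_lorentz]
  bilinear_lsub[OF bilinear_lorentz] bilinear_rsub[OF bilinear_lorentz]
  bilinear_lmul[OF bilinear_lorentz] bilinear_rmul[OF bilinear_lorentz]
  bilinear_lneg[OF bilinear_lorentz] bilinear_rneg[OF bilinear_lorentz]
  bilinear_lzero[OF bilinear_lorentz] bilinear_rzero[OF bilinear_lorentz]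

lemma lorentz_commute: "lorentz v w = lorentz w v"
  by (simp add: lorentz_def inner_commute)

lemma inner_option_vec:
  fixes v w :: "real ^ ('d::finite option)"
  shows "v \<bullet> w = v $ None * w $ None + (\<Sum>j\<in>UNIV. v $ Some j * w $ Some j)"
  by (simp add: inner_vec_def UNIV_option_conv sum.reindex)

lemma lorentz_homogenize [simp]: "lorentz (homogenize x) (homogenize y) = 1 - x \<bullet> y"
  by (simp add: lorentz_def inner_option_vec) (simp add: inner_vec_def)

lemma lorentz_time_axis: "lorentz v (homogenize 0) = v $ None"
  by (simp add: lorentz_def inner_option_vec)

lemma homogenize_add: "homogenize (x + y) = homogenize x + homogenize y - homogenize 0"
  by (simp add: vec_eq_iff homogenize_def split: option.split)

lemma homogenize_scaleR: "homogenize (c *\<^sub>R x) = c *\<^sub>R homogenize x + (1 - c) *\<^sub>R homogenize 0"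
  by (simp add: vec_eq_iff homogenize_def split: option.split)

lemma homogenize_decompose:
  obtains x where "v = v $ None *\<^sub>R homogenize 0 + (homogenize x - homogenize 0)"
proof
  show "v = v $ None *\<^sub>R homogenize 0 + (homogenize (\<chi> j. v $ Some j) - homogenize 0)"
    by (simp add: vec_eq_iff homogenize_def split: option.split)
qed

lemma nonneg_lorentz_time_nonzero:
  assumes "0 \<le> lorentz v v" "v \<noteq> 0"
  shows "v $ None \<noteq> 0"
proof
  assume "v $ None = 0"
  then have "v \<bullet> v \<le> 0"
    using assms(1) by (simp add: lorentz_def)
  then show False
    using assms(2) by (metis inner_ge_zero inner_eq_zero_iff order_antisym)
qed

lemma homogenize_multiple:
  assumes "v $ None \<noteq> 0"
  obtains x where "v = v $ None *\<^sub>R homogenize x"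
proof
  show "v = v $ None *\<^sub>R homogenize (\<chi> j. v $ Some j / v $ None)"
    using assms by (simp add: vec_eq_iff homogenize_def split: option.split)
qed

lemma linear_homogenize_diff: "linear (\<lambda>x. homogenize x - homogenize 0)"
  by (rule linearI) (simp_all add: vec_eq_iff homogenize_def split: option.split)

lemma continuous_lorentz [continuous_intros]:
  "continuous F f \<Longrightarrow> continuous F g \<Longrightarrow> continuous F (\<lambda>t. lorentz (f t) (g t))"
  unfolding lorentz_def by (intro continuous_intros)

section \<open>Linear maps that preserve the cone\<close>

text \<open>
  Null vectors are the boundary of the cone. If the image of a null vector were interior, so would
  be the images of all nearby vectors; but lengthening the space part of a null vector leaves the
  cone at once.
\<close>

lemma null_vector_image:
  fixes f :: "real ^ ('d::finite option) \<Rightarrow> real ^ ('d option)"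
  assumes f: "linear f"
    and cone: "\<And>v. 0 \<le> lorentz (f v) (f v) \<longleftrightarrow> 0 \<le> lorentz v v"
    and v: "lorentz v v = 0"
  shows "lorentz (f v) (f v) = 0"
proof (rule ccontr)
  assume "lorentz (f v) (f v) \<noteq> 0"
  then have pos: "0 < lorentz (f v) (f v)"
    using cone[of v] v by simp
  then have "v \<noteq> 0"
    using linear_0[OF f] by (auto simp: lorentz_simps)
  then have v0: "v $ None \<noteq> 0"
    using nonneg_lorentz_time_nonzero[of v] v by simp
  \<comment> \<open>The space part of \<open>v\<close>, as a homogeneous vector.\<close>
  define w where "w = v - v $ None *\<^sub>R homogenize 0"
  define q where "q t = lorentz (f v + t *\<^sub>R f w) (f v + t *\<^sub>R f w)" for t
  have "isCont q 0"
    unfolding q_def by (intro continuous_intros)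
  moreover have "0 < q 0"
    using pos by (simp add: q_def)
  ultimately have "eventually (\<lambda>t. 0 < q t) (at 0)"
    unfolding isCont_def by (rule order_tendstoD)
  then obtain e where e: "0 < e" "\<And>t. t \<noteq> 0 \<Longrightarrow> dist t 0 < e \<Longrightarrow> 0 < q t"
    unfolding eventually_at by auto
  have "0 < q (e / 2)"
    using e by simp
  then have "0 \<le> lorentz (f (v + (e / 2) *\<^sub>R w)) (f (v + (e / 2) *\<^sub>R w))"
    by (simp add: q_def linear_add[OF f] linear_scale[OF f])
  then have "0 \<le> lorentz (v + (e / 2) *\<^sub>R w) (v + (e / 2) *\<^sub>R w)"
    by (simp only: cone)
  also have "\<dots> = - (e + e\<^sup>2 / 4) * (v $ None)\<^sup>2"
    using v lorentz_commute[of "homogenize 0" v]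
    by (simp add: w_def lorentz_simps lorentz_time_axis)
       (simp add: field_simps power2_eq_square)
  also have "\<dots> < 0"
  proof (rule mult_neg_pos)
    show "- (e + e\<^sup>2 / 4) < 0"
      unfolding neg_less_0_iff_less using e(1) by (intro add_pos_pos) simp_all
  qed (use v0 in simp)
  finally show False by simp
qed

text \<open>
  The form pulled back along \<open>f\<close> is a quadratic form that vanishes on the null vectors. Evaluating it
  at \<open>(1, u)\<close> and \<open>(1, -u)\<close> for unit vectors \<open>u\<close> shows that it has no mixed term and is constant on
  the unit sphere of space, with value opposite to that on the time axis. So it is a multiple of the
  Lorentz form.
\<close>

lemma cone_preserving_conformal:
  fixes f :: "real ^ ('d::finite option) \<Rightarrow> real ^ ('d option)"
  assumes f: "linear f" "surj f"
    and cone: "\<And>v. 0 \<le> lorentz (f v) (f v) \<longleftrightarrow> 0 \<le> lorentz v v"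
  obtains a where "0 < a" "\<And>v w. lorentz (f v) (f w) = a * lorentz v w"
proof -
  define e :: "real ^ ('d option)" where "e = homogenize 0"
  define s where "s x = homogenize x - e" for x :: "real ^ 'd"
  define a where "a = lorentz (f e) (f e)"
  have fs: "f (c *\<^sub>R v + w) = c *\<^sub>R f v + f w" for c v w
    by (simp add: linear_add[OF f(1)] linear_scale[OF f(1)])
  have s_scale: "s (c *\<^sub>R x) = c *\<^sub>R s x" for c x
    using linear_scale[OF linear_homogenize_diff, of c x] by (simp add: s_def e_def)
  have unit: "lorentz (f e) (f (s u)) = 0 \<and> lorentz (f (s u)) (f (s u)) = - a" if "norm u = 1" for u
  proof -
    have uu: "u \<bullet> u = 1"
      using that by (simp add: norm_eq_sqrt_inner)
    have 1: "homogenize u = e + s u" and 2: "homogenize (- u) = e - s u"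
      using s_scale[of "-1" u] by (auto simp: s_def algebra_simps)
    have "lorentz (f (e + s u)) (f (e + s u)) = 0"
      by (rule null_vector_image[OF f(1) cone]) (simp add: 1[symmetric] uu)
    moreover have "lorentz (f (e - s u)) (f (e - s u)) = 0"
      by (rule null_vector_image[OF f(1) cone]) (simp add: 2[symmetric] uu)
    ultimately show ?thesis
      using lorentz_commute[of "f e" "f (s u)"]
      by (simp add: linear_add[OF f(1)] linear_diff[OF f(1)] lorentz_simps a_def)
  qed
  have space: "lorentz (f e) (f (s x)) = 0 \<and> lorentz (f (s x)) (f (s x)) = - a * (x \<bullet> x)" for x
  proof (cases "x = 0")
    case True
    then show ?thesis
      by (simp add: s_def e_def linear_0[OF f(1)] lorentz_simps)
  next
    case False
    define u where "u = (1 / norm x) *\<^sub>R x"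
    have "norm u = 1" and x: "x = norm x *\<^sub>R u"
      using False by (auto simp: u_def)
    have "f (s x) = norm x *\<^sub>R f (s u)"
      by (subst x) (simp only: s_scale linear_scale[OF f(1)])
    then show ?thesis
      using unit[OF \<open>norm u = 1\<close>]
      by (simp add: lorentz_simps dot_square_norm power2_eq_square)
  qed
  have quad: "lorentz (f v) (f v) = a * lorentz v v" for v
  proof -
    obtain x where v: "v = v $ None *\<^sub>R e + s x"
      using homogenize_decompose[of v] by (auto simp: s_def e_def)
    have "lorentz v v = (v $ None)\<^sup>2 - x \<bullet> x"
      by (subst v, subst (2) v) (simp add: s_def e_def lorentz_simps power2_eq_square)
    moreover have "lorentz (f v) (f v) = a * (v $ None)\<^sup>2 - a * (x \<bullet> x)"
      using space[of x] lorentz_commute[of "f e" "f (s x)"]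
      by (subst v, subst (2) v) (simp add: fs lorentz_simps a_def power2_eq_square)
    ultimately show ?thesis
      by (simp add: right_diff_distrib)
  qed
  have polar: "lorentz (f v) (f w) = a * lorentz v w" for v w
    using quad[of "v + w"] quad[of v] quad[of w]
      lorentz_commute[of w v] lorentz_commute[of "f w" "f v"]
    by (simp add: linear_add[OF f(1)] lorentz_simps algebra_simps)
  have "a \<ge> 0"
    using cone[of e] by (simp add: a_def e_def)
  moreover have "a \<noteq> 0"
  proof
    assume "a = 0"
    obtain v where "e = f v"
      using f(2) by (metis surjD)
    then have "lorentz e e = 0"
      using quad[of v] \<open>a = 0\<close> by simp
    then show False
      by (simp add: e_def)
  qed
  ultimately show thesis
    using polar that[of a] by simp
qed

section \<open>Projective transformations and the ball\<close>

definition projective_map ::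
    "(real ^ ('d::finite option) \<Rightarrow> real ^ ('d option)) \<Rightarrow> 'd RP \<Rightarrow> 'd RP"
  where "projective_map f P = RP_of_line (f ` line_of P)"

lemma line_of_projective_map:
  fixes f :: "real ^ ('d::finite option) \<Rightarrow> real ^ ('d option)"
  assumes "linear f" "inj f"
  shows "line_of (projective_map f P) = f ` line_of P"
proof -
  have "subspace (line_of P)" "dim (line_of P) = 1"
    using line_of[of P] by auto
  then have "subspace (f ` line_of P)" "dim (f ` line_of P) = 1"
    using assms linear_subspace_image dim_image_eq[of f "line_of P"]
    by (auto intro: inj_on_subset)
  then show ?thesis
    by (simp add: projective_map_def RP_of_line_inverse)
qed

lemma bij_if_line_of_image:
  fixes f :: "real ^ ('d::finite option) \<Rightarrow> real ^ ('d option)"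
  assumes f: "linear f" "bij f" and \<phi>: "\<And>P. line_of (\<phi> P) = f ` line_of P"
  shows "bij \<phi>"
proof (rule bijI)
  show "inj \<phi>"
    using f(2) \<phi> by (metis bij_is_inj inj_image_eq_iff injI line_of_inject)
  have lin: "linear (inv f)" "inj (inv f)"
    using inj_linear_imp_inv_linear[OF f(1) bij_is_inj[OF f(2)]] bij_is_inj[OF bij_imp_bij_inv[OF f(2)]]
    by auto
  have "\<phi> (projective_map (inv f) P) = P" for P
  proof -
    have "line_of (\<phi> (projective_map (inv f) P)) = f ` inv f ` line_of P"
      by (simp add: \<phi> line_of_projective_map[OF lin])
    also have "\<dots> = line_of P"
      using f(2) by (simp add: image_f_inv_f bij_is_surj)
    finally show ?thesis
      by (simp add: line_of_inject)
  qed
  then show "surj \<phi>"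
    by (metis surjI)
qed

lemma chart_eq_iff: "P = chart x \<longleftrightarrow> homogenize x \<in> line_of P"
proof
  assume "P = chart x"
  then show "homogenize x \<in> line_of P"
    by (simp add: line_of_chart span_base)
next
  assume *: "homogenize x \<in> line_of P"
  have "subspace (line_of P)" "dim (line_of P) = 1"
    using line_of[of P] by auto
  moreover have "span {homogenize x} \<subseteq> line_of P"
    using * \<open>subspace (line_of P)\<close> by (simp add: span_minimal)
  moreover have "dim (span {homogenize x}) = 1"
    by (simp add: dim_span_eq_card_independent)
  ultimately have "line_of (chart x) = line_of P"
    unfolding line_of_chart by (metis order_refl subspace_dim_equal subspace_span)
  then show "P = chart x"
    by (simp add: line_of_inject)
qed

text \<open>
  A line through the origin represents a point of the ball iff one, equivalently every, nonzero
  vector on it lies in the cone. A line representing a point at infinity meets the cone only in \<open>0\<close>.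
\<close>

lemma chart_ball_iff_lorentz:
  assumes "v \<in> line_of P" "v \<noteq> 0"
  shows "P \<in> chart ` cball 0 1 \<longleftrightarrow> 0 \<le> lorentz v v"
proof
  assume "P \<in> chart ` cball 0 1"
  then obtain x where x: "norm x \<le> 1" "P = chart x"
    by auto
  then obtain c where "v = c *\<^sub>R homogenize x"
    using assms(1) by (auto simp: line_of_chart span_singleton)
  moreover have "x \<bullet> x \<le> 1"
    using x(1) by (simp add: dot_square_norm power_le_one_iff)
  then have "0 \<le> c\<^sup>2 * (1 - x \<bullet> x)"
    by simp
  ultimately show "0 \<le> lorentz v v"
    by (simp add: lorentz_simps power2_eq_square mult.assoc)
next
  assume nonneg: "0 \<le> lorentz v v"
  define c where "c = v $ None"
  have c: "c \<noteq> 0"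
    using nonneg_lorentz_time_nonzero[OF nonneg assms(2)] by (simp add: c_def)
  then obtain x where v: "v = c *\<^sub>R homogenize x"
    using homogenize_multiple[of v] by (auto simp: c_def)
  have "subspace (line_of P)"
    using line_of[of P] by auto
  then have "(1 / c) *\<^sub>R v \<in> line_of P"
    using assms(1) by (rule subspace_scale)
  then have "P = chart x"
    using c by (simp add: v chart_eq_iff)
  moreover have "0 \<le> c\<^sup>2 * (1 - x \<bullet> x)"
    using nonneg by (simp add: v lorentz_simps power2_eq_square mult.assoc)
  then have "x \<bullet> x \<le> 1"
    using c by (simp add: zero_le_mult_iff)
  then have "norm x \<le> 1"
    by (simp add: norm_le_square)
  ultimately show "P \<in> chart ` cball 0 1"
    by auto
qed

lemma preserves_ball_iff_preserves_cone:
  fixes \<phi> :: "'d::finite RP \<Rightarrow> 'd RP"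
  assumes f: "linear f" "bij f" and \<phi>: "\<And>P. line_of (\<phi> P) = f ` line_of P"
  shows "\<phi> ` (chart ` cball 0 1) = chart ` cball 0 1 \<longleftrightarrow>
    (\<forall>v. 0 \<le> lorentz (f v) (f v) \<longleftrightarrow> 0 \<le> lorentz v v)"
proof -
  let ?B = "chart ` cball 0 1 :: 'd RP set"
  have "bij \<phi>"
    using bij_if_line_of_image[OF f \<phi>] .
  have image: "\<phi> ` ?B = ?B \<longleftrightarrow> (\<forall>P. \<phi> P \<in> ?B \<longleftrightarrow> P \<in> ?B)"
  proof
    assume "\<phi> ` ?B = ?B"
    then show "\<forall>P. \<phi> P \<in> ?B \<longleftrightarrow> P \<in> ?B"
      using inj_image_mem_iff[OF bij_is_inj[OF \<open>bij \<phi>\<close>], of _ ?B] by simp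
  next
    assume "\<forall>P. \<phi> P \<in> ?B \<longleftrightarrow> P \<in> ?B"
    then have "\<phi> -` ?B = ?B"
      by (simp add: vimage_def)
    then show "\<phi> ` ?B = ?B"
      using surj_image_vimage_eq[OF bij_is_surj[OF \<open>bij \<phi>\<close>], of ?B] by simp
  qed
  have f0: "f v = 0 \<longleftrightarrow> v = 0" for v
    using linear_injective_0[OF f(1)] bij_is_inj[OF f(2)] linear_0[OF f(1)] by auto
  have cone: "(\<phi> P \<in> ?B \<longleftrightarrow> P \<in> ?B) \<longleftrightarrow> (0 \<le> lorentz (f v) (f v) \<longleftrightarrow> 0 \<le> lorentz v v)"
    if "v \<in> line_of P" "v \<noteq> 0" for P v
    using that chart_ball_iff_lorentz[of v P] chart_ball_iff_lorentz[of "f v" "\<phi> P"]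
    by (simp add: \<phi> f0)
  have point: "\<exists>v. v \<in> line_of P \<and> v \<noteq> 0" for P :: "'d RP"
  proof (rule ccontr)
    assume "\<not> ?thesis"
    then have "line_of P \<subseteq> {0}"
      by blast
    then show False
      using line_of[of P] dim_eq_0[of "line_of P"] by simp
  qed
  have line: "\<exists>P. v \<in> line_of P" if "v \<noteq> 0" for v :: "real ^ ('d option)"
  proof
    show "v \<in> line_of (RP_of_line (span {v}))"
      using that by (subst RP_of_line_inverse) (auto simp: dim_span_eq_card_independent span_base)
  qed
  show ?thesis
    unfolding image
  proof (rule iffI; rule allI)
    fix v
    assume *: "\<forall>P. \<phi> P \<in> ?B \<longleftrightarrow> P \<in> ?B"
    show "0 \<le> lorentz (f v) (f v) \<longleftrightarrow> 0 \<le> lorentz v v"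
    proof (cases "v = 0")
      case True
      then show ?thesis
        by (simp add: linear_0[OF f(1)])
    next
      case False
      then show ?thesis
        using line[OF False] cone * by blast
    qed
  next
    fix P
    assume "\<forall>v. 0 \<le> lorentz (f v) (f v) \<longleftrightarrow> 0 \<le> lorentz v v"
    then show "\<phi> P \<in> ?B \<longleftrightarrow> P \<in> ?B"
      using point[of P] cone by blast
  qed
qed

section \<open>The balance point of finitely many points of the ball\<close>

text \<open>Strict convexity of the ball, by the parallelogram law.\<close>

lemma norm_add_less_if_distinct:
  fixes p q :: "'a::real_inner"
  assumes "norm p \<le> 1" "norm q \<le> 1" "p \<noteq> q"
  shows "norm (p + q) < 2"
proof -
  have "(norm (p + q))\<^sup>2 + (norm (p - q))\<^sup>2 = 2 * (norm p)\<^sup>2 + 2 * (norm q)\<^sup>2"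
    by (simp add: power2_norm_eq_inner inner_add_left inner_add_right inner_diff_left inner_diff_right inner_commute)
  moreover have "(norm p)\<^sup>2 \<le> 1" "(norm q)\<^sup>2 \<le> 1"
    using assms by (auto simp: power_le_one)
  moreover have "(norm (p - q))\<^sup>2 > 0"
    using assms(3) by simp
  ultimately have "(norm (p + q))\<^sup>2 < 4"
    by linarith
  then have "(norm (p + q))\<^sup>2 < 2\<^sup>2"
    by simp
  then show ?thesis
    by (rule power2_less_imp_less) simp
qed

lemma inner_less_one:
  fixes p y :: "'a::real_inner"
  assumes "norm p \<le> 1" "norm y < 1"
  shows "p \<bullet> y < 1"
proof -
  have "p \<bullet> y \<le> norm p * norm y"
    by (rule norm_cauchy_schwarz)
  also have "\<dots> \<le> norm y"
    using assms(1) by (simp add: mult_left_le_one_le)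
  finally show ?thesis
    using assms(2) by simp
qed

text \<open>
  This is \<open>\<Sum>ln \<langle>h\<^sub>p, x\<rangle>\<close>, where \<open>h\<^sub>p = (1, p)\<close> and \<open>x = (1, y) / sqrt (1 - y \<bullet> y)\<close> is the point of the
  hyperboloid over \<open>y\<close> in the Klein model.
\<close>

definition centering_potential :: "'a::real_inner set \<Rightarrow> 'a \<Rightarrow> real"
  where "centering_potential S y = (\<Sum>p\<in>S. ln (1 - p \<bullet> y)) - real (card S) / 2 * ln (1 - y \<bullet> y)"

text \<open>
  For distinct \<open>p\<close> and \<open>q\<close> in the ball, \<open>(1 - p \<bullet> y) + (1 - q \<bullet> y) \<ge> 2 - \<parallel>p + q\<parallel>\<close> is bounded below by
  a positive number, uniformly in \<open>y\<close>. So all summands \<open>ln (1 - p \<bullet> y)\<close> but one are bounded below,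
  and the exceptional one is at least \<open>ln (1 - y \<bullet> y)\<close> up to a constant. The potential is then at
  least \<open>- (card S / 2 - 1) ln (1 - y \<bullet> y)\<close> up to a constant, and the coefficient is negative because
  there are more than two points. The conclusion says that the sublevel set of the value at the
  origin stays away from the unit sphere.
\<close>

lemma centering_potential_coercive:
  fixes S :: "'a::real_inner set"
  assumes S: "finite S" "S \<subseteq> cball 0 1" "card S \<ge> 3"
  obtains M where "\<And>y. norm y < 1 \<Longrightarrow> centering_potential S y \<le> 0 \<Longrightarrow> M \<le> ln (1 - y \<bullet> y)"
proof -
  \<comment> \<open>The element \<open>1\<close> keeps the set nonempty.\<close>
  define D where "D = insert 1 ((\<lambda>(p, q). 1 - norm (p + q) / 2) ` {(p, q) \<in> S \<times> S. p \<noteq> q})"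
  define \<delta> where "\<delta> = Min D"
  have "finite {(p, q) \<in> S \<times> S. p \<noteq> q}"
    by (rule finite_subset[of _ "S \<times> S"]) (auto simp: S)
  then have D: "finite D" "D \<noteq> {}"
    by (auto simp: D_def)
  have "x > 0" if "x \<in> D" for x
    using that norm_add_less_if_distinct S(2) by (fastforce simp: D_def subset_iff)
  then have \<delta>: "0 < \<delta>"
    using D by (simp add: \<delta>_def)
  have \<delta>_le: "\<delta> \<le> 1 - norm (p + q) / 2" if "p \<in> S" "q \<in> S" "p \<noteq> q" for p q
    unfolding \<delta>_def using that by (intro Min_le D) (auto simp: D_def)
  define M where "M = 2 * ((real (card S) - 1) * ln \<delta> - ln 2)"
  have "M \<le> ln (1 - y \<bullet> y)" if y: "norm y < 1" and le0: "centering_potential S y \<le> 0" for y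
  proof -
    have pos: "0 < 1 - p \<bullet> y" if "p \<in> S" for p
      using inner_less_one[OF _ y, of p] S(2) that by auto
    have apart: "\<delta> \<le> 1 - p \<bullet> y \<or> \<delta> \<le> 1 - q \<bullet> y" if "p \<in> S" "q \<in> S" "p \<noteq> q" for p q
    proof -
      have "(p + q) \<bullet> y \<le> norm (p + q) * norm y"
        by (rule norm_cauchy_schwarz)
      also have "\<dots> \<le> norm (p + q)"
        using y by (simp add: mult_left_le)
      finally show ?thesis
        using \<delta>_le[OF that] unfolding inner_add_left by linarith
    qed
    \<comment> \<open>The only point whose factor may be small; any point of \<open>S\<close> if there is none.\<close>
    obtain r where r: "r \<in> S" "\<And>p. p \<in> S - {r} \<Longrightarrow> \<delta> \<le> 1 - p \<bullet> y"
    proof (cases "\<exists>r\<in>S. \<not> \<delta> \<le> 1 - r \<bullet> y")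
      case True
      then show ?thesis
        using apart that by blast
    next
      case False
      moreover have "S \<noteq> {}"
        using S(3) by auto
      ultimately show ?thesis
        using that by blast
    qed
    have yy: "y \<bullet> y = (norm y)\<^sup>2" "(norm y)\<^sup>2 < 1"
      using y by (simp_all add: dot_square_norm power_less_one_iff)
    have "r \<bullet> y \<le> norm r * norm y"
      by (rule norm_cauchy_schwarz)
    also have "\<dots> \<le> norm y"
      using r(1) S(2) by (auto simp: mult_left_le_one_le)
    finally have "1 - norm y \<le> 1 - r \<bullet> y"
      by simp
    moreover have "(1 - (norm y)\<^sup>2) / 2 \<le> 1 - norm y"
      using zero_le_power2[of "1 - norm y"] by (simp add: power2_eq_square field_simps)
    ultimately have "ln ((1 - y \<bullet> y) / 2) \<le> ln (1 - r \<bullet> y)"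
      using yy by (intro ln_mono) auto
    then have lnr: "ln (1 - y \<bullet> y) - ln 2 \<le> ln (1 - r \<bullet> y)"
      using yy by (simp add: ln_div)
    have "real (card (S - {r})) * ln \<delta> \<le> (\<Sum>p\<in>S - {r}. ln (1 - p \<bullet> y))"
    proof (rule sum_bounded_below)
      fix p assume "p \<in> S - {r}"
      then show "ln \<delta> \<le> ln (1 - p \<bullet> y)"
        using \<delta> r(2) pos by (intro ln_mono) auto
    qed
    then have "(real (card S) - 1) * ln \<delta> \<le> (\<Sum>p\<in>S - {r}. ln (1 - p \<bullet> y))"
      using r(1) S by (simp add: of_nat_diff)
    moreover have "(\<Sum>p\<in>S. ln (1 - p \<bullet> y)) = ln (1 - r \<bullet> y) + (\<Sum>p\<in>S - {r}. ln (1 - p \<bullet> y))"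
      using S(1) r(1) by (rule sum.remove)
    moreover have "M / 2 = (real (card S) - 1) * ln \<delta> - ln 2"
      by (simp add: M_def)
    moreover have "(real (card S) / 2 - 1) * ln (1 - y \<bullet> y)
        = real (card S) / 2 * ln (1 - y \<bullet> y) - ln (1 - y \<bullet> y)"
      by (simp add: left_diff_distrib)
    ultimately have "M / 2 \<le> (real (card S) / 2 - 1) * ln (1 - y \<bullet> y)"
      using lnr le0 unfolding centering_potential_def by linarith
    also have "\<dots> \<le> 1 / 2 * ln (1 - y \<bullet> y)"
      using S(3) yy by (intro mult_right_mono_neg) auto
    finally show ?thesis
      by simp
  qed
  then show thesis
    using that by blast
qed

lemma centering_potential_attains_inf:
  fixes S :: "'a::euclidean_space set"
  assumes S: "finite S" "S \<subseteq> cball 0 1" "card S \<ge> 3"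
  obtains y where "norm y < 1" "\<And>z. norm z < 1 \<Longrightarrow> centering_potential S y \<le> centering_potential S z"
proof -
  let ?F = "centering_potential S"
  obtain M where M: "\<And>y. norm y < 1 \<Longrightarrow> ?F y \<le> 0 \<Longrightarrow> M \<le> ln (1 - y \<bullet> y)"
    using centering_potential_coercive[OF S] by blast
  have F0: "?F 0 = 0"
    by (simp add: centering_potential_def)
  then have "M \<le> 0"
    using M[of 0] by simp
  \<comment> \<open>The ball on which \<open>M \<le> ln (1 - z \<bullet> z)\<close>; outside it the potential exceeds its value at \<open>0\<close>.\<close>
  define K where "K = cball (0::'a) (sqrt (1 - exp M))"
  have K_sub: "norm y < 1" if "y \<in> K" for y
  proof -
    have "norm y \<le> sqrt (1 - exp M)"
      using that by (simp add: K_def)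
    also have "\<dots> < 1"
      by simp
    finally show ?thesis .
  qed
  have "continuous_on K ?F"
    unfolding centering_potential_def
  proof (intro continuous_intros ballI)
    fix y p assume y: "y \<in> K"
    show "1 - y \<bullet> y \<noteq> 0"
      using inner_less_one[of y y] K_sub[OF y] by simp
    assume "p \<in> S"
    then have "norm p \<le> 1"
      using S(2) by auto
    then show "1 - p \<bullet> y \<noteq> 0"
      using inner_less_one[of p y] K_sub[OF y] by simp
  qed
  moreover have "compact K" "0 \<in> K"
    using \<open>M \<le> 0\<close> by (auto simp: K_def)
  ultimately obtain y where y: "y \<in> K" "\<And>z. z \<in> K \<Longrightarrow> ?F y \<le> ?F z"
    using continuous_attains_inf[of K ?F] by blast
  have "?F y \<le> ?F z" if z: "norm z < 1" for z
  proof (cases "z \<in> K")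
    case True
    then show ?thesis by (rule y(2))
  next
    case False
    have "0 < ?F z"
    proof (rule ccontr)
      assume "\<not> 0 < ?F z"
      then have "M \<le> ln (1 - z \<bullet> z)"
        using M[OF z] by simp
      then have "exp M \<le> 1 - z \<bullet> z"
        using inner_less_one[of z z] z by (simp add: ln_ge_iff)
      then have "norm z \<le> sqrt (1 - exp M)"
        by (intro real_le_rsqrt) (simp add: dot_square_norm)
      then show False
        using False by (simp add: K_def)
    qed
    then show ?thesis
      using y(2)[OF \<open>0 \<in> K\<close>] F0 by simp
  qed
  then show thesis
    using that[of y] K_sub[OF y(1)] by blast
qed

text \<open>The equation says that the gradient of the potential vanishes at its minimiser.\<close>

lemma exists_balance_point:
  fixes S :: "'a::euclidean_space set"
  assumes S: "finite S" "S \<subseteq> cball 0 1" "card S \<ge> 3"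
  obtains y where "norm y < 1"
    "(\<Sum>p\<in>S. (1 / (1 - p \<bullet> y)) *\<^sub>R p) = (real (card S) / (1 - y \<bullet> y)) *\<^sub>R y"
proof -
  let ?F = "centering_potential S"
  obtain y where y: "norm y < 1" and min: "\<And>z. norm z < 1 \<Longrightarrow> ?F y \<le> ?F z"
    using centering_potential_attains_inf[OF S] by blast
  have yy: "y \<bullet> y < 1"
    using inner_less_one[of y y] y by simp
  have py: "p \<bullet> y < 1" if "p \<in> S" for p
    using inner_less_one[OF _ y, of p] S(2) that by auto
  let ?g = "(real (card S) / (1 - y \<bullet> y)) *\<^sub>R y - (\<Sum>p\<in>S. (1 / (1 - p \<bullet> y)) *\<^sub>R p)"
  have "(?F has_derivative (\<lambda>v. ?g \<bullet> v)) (at y)"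
  proof -
    have 1: "((\<lambda>z. ln (1 - p \<bullet> z)) has_derivative (\<lambda>v. - ((1 / (1 - p \<bullet> y)) *\<^sub>R p) \<bullet> v)) (at y)"
      if "p \<in> S" for p
      using py[OF that] by (auto intro!: derivative_eq_intros simp: field_simps)
    have 2: "((\<lambda>z. ln (1 - z \<bullet> z)) has_derivative (\<lambda>v. - (2 / (1 - y \<bullet> y)) * (y \<bullet> v))) (at y)"
      using yy by (auto intro!: derivative_eq_intros simp: field_simps inner_commute)
    show ?thesis
      unfolding centering_potential_def
      by (rule has_derivative_eq_rhs[OF has_derivative_diff[OF has_derivative_sum[OF 1]
            has_derivative_mult_right[OF 2]]])
        (auto simp: fun_eq_iff inner_diff_left inner_sum_left sum_negf)
  qed
  moreover have "y \<in> ball 0 1" "open (ball (0::'a) 1)" "\<forall>z\<in>ball 0 1. ?F y \<le> ?F z"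
    using y min by auto
  ultimately have "(\<lambda>v. ?g \<bullet> v) = (\<lambda>v. 0)"
    using differential_zero_maxmin[of y "ball 0 1" ?F "\<lambda>v. ?g \<bullet> v"] by blast
  then have "?g \<bullet> ?g = 0"
    by meson
  then have "?g = 0"
    by (simp only: inner_eq_zero_iff)
  then show thesis
    using that[OF y] by simp
qed

section \<open>Existence of a centering transformation\<close>

text \<open>
  The Lorentz isometry that fixes \<open>m\<close> and is \<open>-1\<close> on its orthogonal complement. When \<open>m\<close> is the sum of
  two vectors of equal Lorentz square, it exchanges them; for \<open>(1, y)\<close> and
  \<open>sqrt (1 - y \<bullet> y) e\<close>, where \<open>e = (1, 0)\<close>, this takes the line of \<open>(1, y)\<close> to the time axis.
\<close>

definition lorentz_half_turn ::
    "real ^ ('d::finite option) \<Rightarrow> real ^ ('d option) \<Rightarrow> real ^ ('d option)"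
  where "lorentz_half_turn m v = (2 * lorentz v m / lorentz m m) *\<^sub>R m - v"

lemma linear_lorentz_half_turn: "linear (lorentz_half_turn m)"
  by (rule linearI)
    (simp_all add: lorentz_half_turn_def lorentz_simps algebra_simps add_divide_distrib scaleR_add_left)

lemma lorentz_half_turn_invariant:
  assumes "lorentz m m \<noteq> 0"
  shows "lorentz (lorentz_half_turn m v) (lorentz_half_turn m w) = lorentz v w"
proof -
  have "2 * lorentz v m / lorentz m m * (2 * lorentz w m / lorentz m m * lorentz m m)
      = 2 * (2 * lorentz v m * lorentz w m / lorentz m m)"
    using assms by simp
  then show ?thesis
    using lorentz_commute[of m w] by (simp add: lorentz_half_turn_def lorentz_simps)
qed

lemma lorentz_half_turn_involutive:
  assumes "lorentz m m \<noteq> 0"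
  shows "lorentz_half_turn m (lorentz_half_turn m v) = v"
  using assms by (simp add: lorentz_half_turn_def lorentz_simps)

text \<open>
  At a balance point \<open>y\<close> the homogeneous vectors of the \<open>p\<^sub>i\<close>, weighted by \<open>1 / (1 - p\<^sub>i \<bullet> y)\<close>, add up
  to a multiple of \<open>(1, y)\<close>. The half-turn that brings \<open>(1, y)\<close> to the time axis turns these weights
  into the ones that normalise the time components of the images to a common value.
\<close>

lemma centering_transformation_exists:
  fixes p :: "nat \<Rightarrow> real ^ 'd::finite"
  assumes n: "n \<ge> 3" and inj: "inj_on p {1..n}" and ball: "\<forall>i\<in>{1..n}. p i \<in> cball 0 1"
  shows "\<exists>\<phi>. centering_transformation n p \<phi>"
proof -
  have card: "card (p ` {1..n}) = n"
    using card_image[OF inj] by simp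
  have S: "finite (p ` {1..n})" "p ` {1..n} \<subseteq> cball 0 1" "card (p ` {1..n}) \<ge> 3"
    using ball n unfolding card by blast+
  obtain y where y: "norm y < 1" and
    eq: "(\<Sum>q\<in>p ` {1..n}. (1 / (1 - q \<bullet> y)) *\<^sub>R q) = (real n / (1 - y \<bullet> y)) *\<^sub>R y"
    using exists_balance_point[OF S] unfolding card by blast
  define r where "r i = 1 - p i \<bullet> y" for i
  define k where "k = sqrt (1 - y \<bullet> y)"
  have yy: "y \<bullet> y < 1"
    using inner_less_one[of y y] y by simp
  then have k: "0 < k" "k * k = 1 - y \<bullet> y"
    by (auto simp: k_def)
  have r: "0 < r i" if "i \<in> {1..n}" for i
    using inner_less_one[OF _ y, of "p i"] ball that by (auto simp: r_def)
  have sum_p: "(\<Sum>i=1..n. (1 / r i) *\<^sub>R p i) = (real n / (k * k)) *\<^sub>R y"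
    using eq inj unfolding k(2) r_def by (simp add: sum.reindex)
  \<comment> \<open>The time component of the balance equation, obtained from the inner product of its space
      component with \<open>y\<close>.\<close>
  have sum_1: "(\<Sum>i=1..n. 1 / r i) = real n / (k * k)"
  proof -
    have "(\<Sum>i=1..n. 1 / r i) = (\<Sum>i=1..n. 1 + ((1 / r i) *\<^sub>R p i) \<bullet> y)"
    proof (rule sum.cong)
      fix i assume "i \<in> {1..n}"
      then show "1 / r i = 1 + ((1 / r i) *\<^sub>R p i) \<bullet> y"
        using r[of i] by (simp add: field_simps) (simp add: r_def)
    qed simp
    also have "\<dots> = real n + (\<Sum>i=1..n. (1 / r i) *\<^sub>R p i) \<bullet> y"
      by (simp add: sum.distrib inner_sum_left)
    also have "\<dots> = real n / (k * k)"
      using yy unfolding sum_p k(2) by (simp add: field_simps)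
    finally show ?thesis .
  qed
  have sum_h: "(\<Sum>i=1..n. (1 / r i) *\<^sub>R homogenize (p i)) = (real n / (k * k)) *\<^sub>R homogenize y"
    unfolding vec_eq_iff
  proof
    fix i
    show "(\<Sum>i=1..n. (1 / r i) *\<^sub>R homogenize (p i)) $ i = ((real n / (k * k)) *\<^sub>R homogenize y) $ i"
    proof (cases i)
      case None
      then show ?thesis
        using sum_1 by simp
    next
      case (Some j)
      then show ?thesis
        using arg_cong[OF sum_p, of "\<lambda>v. v $ j"] by simp
    qed
  qed
  define m where "m = homogenize y + k *\<^sub>R homogenize 0"
  define L where "L = lorentz_half_turn m"
  have mm: "lorentz m m = 2 * k * (k + 1)"
    using k by (simp add: m_def lorentz_simps algebra_simps)
  then have m0: "lorentz m m \<noteq> 0"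
    using k by simp
  have lin: "linear L"
    by (simp add: L_def linear_lorentz_half_turn)
  have bij: "bij L"
    using lorentz_half_turn_involutive[OF m0] by (auto simp: L_def intro: involuntory_imp_bij)
  have inv: "lorentz (L v) (L w) = lorentz v w" for v w
    by (simp add: L_def lorentz_half_turn_invariant[OF m0])
  have Ly: "L (homogenize y) = k *\<^sub>R homogenize 0"
  proof -
    have "lorentz (homogenize y) m = k * (k + 1)"
      using k by (simp add: m_def lorentz_simps algebra_simps)
    then have "2 * lorentz (homogenize y) m / lorentz m m = 1"
      using mm m0 by simp
    then show ?thesis
      by (simp add: L_def lorentz_half_turn_def m_def)
  qed
  have time: "L (homogenize (p i)) $ None = r i / k" for i
  proof -
    have "k * L (homogenize (p i)) $ None = lorentz (L (homogenize (p i))) (L (homogenize y))"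
      by (simp add: Ly lorentz_simps lorentz_time_axis)
    also have "\<dots> = r i"
      by (simp add: inv r_def)
    finally show ?thesis
      using k(1) by (simp add: field_simps)
  qed
  let ?\<phi> = "projective_map L"
  have line: "line_of (?\<phi> P) = L ` line_of P" for P
    using line_of_projective_map[OF lin bij_is_inj[OF bij]] .
  have proj: "projective_transformation ?\<phi>"
    unfolding projective_transformation_def using lin bij line by blast
  have ball': "?\<phi> ` (chart ` cball 0 1) = chart ` cball 0 1"
    using preserves_ball_iff_preserves_cone[of L ?\<phi>] lin bij line by (simp add: inv)
  define z where "z i = affine_coords (?\<phi> (chart (p i)))" for i
  have z: "homogenize (z i) = (k / r i) *\<^sub>R L (homogenize (p i))" if i: "i \<in> {1..n}" for i
  proof -
    have "L (homogenize (p i)) $ None \<noteq> 0"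
      using r[OF i] k(1) by (simp add: time)
    then obtain x where x: "L (homogenize (p i)) = (r i / k) *\<^sub>R homogenize x"
      using homogenize_multiple[of "L (homogenize (p i))"] unfolding time by blast
    have h: "homogenize x = L ((k / r i) *\<^sub>R homogenize (p i))"
      using r[OF i] k(1) by (simp add: linear_scale[OF lin] x)
    have "homogenize x \<in> line_of (?\<phi> (chart (p i)))"
      unfolding line line_of_chart h by (intro imageI span_scale span_base) simp
    then have "z i = x"
      by (simp add: z_def chart_eq_iff[symmetric])
    then show ?thesis
      using h by (simp add: linear_scale[OF lin])
  qed
  have "(\<Sum>i=1..n. homogenize (z i)) = (\<Sum>i=1..n. k *\<^sub>R L ((1 / r i) *\<^sub>R homogenize (p i)))"
    by (rule sum.cong) (simp_all add: z linear_scale[OF lin])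
  also have "\<dots> = k *\<^sub>R L (\<Sum>i=1..n. (1 / r i) *\<^sub>R homogenize (p i))"
    by (simp only: linear_sum[OF lin] scaleR_sum_right)
  also have "\<dots> = real n *\<^sub>R homogenize 0"
    using k(1) unfolding sum_h by (simp add: linear_scale[OF lin] Ly)
  finally have sum_z: "(\<Sum>i=1..n. homogenize (z i)) = real n *\<^sub>R homogenize 0" .
  have "(\<Sum>i=1..n. z i) $ j = 0" for j
    using arg_cong[OF sum_z, of "\<lambda>v. v $ Some j"] by simp
  then have "(\<Sum>i=1..n. z i) = 0"
    by (simp add: vec_eq_iff)
  then show ?thesis
    using proj ball' unfolding centering_transformation_def z_def by blast
qed

section \<open>Uniqueness up to orthogonal transformations\<close>

text \<open>The equality case of \<open>\<bar>q \<bullet> y\<bar> \<le> \<parallel>y\<parallel>\<close> for \<open>q\<close> in the unit ball.\<close>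

lemma extremal_inner_unit_ball:
  fixes q y :: "'a::real_inner"
  assumes "norm q \<le> 1" "y \<noteq> 0" "(q \<bullet> y)\<^sup>2 = y \<bullet> y"
  shows "q = (1 / norm y) *\<^sub>R y \<or> q = - (1 / norm y) *\<^sub>R y"
proof -
  define u where "u = (1 / norm y) *\<^sub>R y"
  have u: "u \<bullet> u = 1"
    using assms(2) by (simp add: u_def dot_square_norm power2_eq_square)
  have qq: "q \<bullet> q \<le> 1"
    using assms(1) by (simp add: dot_square_norm power_le_one)
  have "(q \<bullet> u)\<^sup>2 = 1"
    using assms(2,3) by (simp add: u_def power_divide dot_square_norm)
  then have "(q - u) \<bullet> (q - u) \<le> 0 \<or> (q + u) \<bullet> (q + u) \<le> 0"
    using u qq unfolding power2_eq_1_iff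
    by (auto simp: inner_diff_left inner_diff_right inner_add_left inner_add_right inner_commute)
  then have "q - u = 0 \<or> q + u = 0"
    by (metis inner_ge_zero inner_eq_zero_iff order_antisym)
  then show ?thesis
    by (auto simp: u_def eq_neg_iff_add_eq_0)
qed

text \<open>
  Let \<open>y \<noteq> 0\<close>. Up to sign and a positive factor depending only on \<open>y\<close>, the summand in the last
  hypothesis is the coordinate along \<open>y\<close> of the image of \<open>q\<^sub>i\<close> under the hyperbolic translation that
  takes \<open>y\<close> to the centre. For every \<open>r < 1\<close>,
  \<open>(y \<bullet> y - r) / (1 - r) + r = (y \<bullet> y - r\<^sup>2) / (1 - r)\<close>, which is nonnegative for
  \<open>r = q\<^sub>i \<bullet> y\<close>. Both terms on the left sum to zero over \<open>i\<close>, so each of these terms is zero and every \<open>q\<^sub>i\<close> is one of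
  the two endpoints of the diameter through \<open>y\<close>.
\<close>

lemma boost_displaces_centroid:
  fixes q :: "nat \<Rightarrow> 'a::real_inner"
  assumes n: "n \<ge> 3" and inj: "inj_on q {1..n}" and ball: "\<And>i. i \<in> {1..n} \<Longrightarrow> norm (q i) \<le> 1"
    and y: "norm y < 1"
    and sum_q: "(\<Sum>i=1..n. q i) = 0"
    and sum_y: "(\<Sum>i=1..n. (y \<bullet> y - q i \<bullet> y) / (1 - q i \<bullet> y)) = 0"
  shows "y = 0"
proof (rule ccontr)
  assume "y \<noteq> 0"
  define g where "g i = (y \<bullet> y - (q i \<bullet> y)\<^sup>2) / (1 - q i \<bullet> y)" for i
  have pos: "0 < 1 - q i \<bullet> y" if "i \<in> {1..n}" for i
    using inner_less_one[OF ball[OF that] y] by simp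
  have "(\<Sum>i=1..n. g i) = (\<Sum>i=1..n. (y \<bullet> y - q i \<bullet> y) / (1 - q i \<bullet> y) + q i \<bullet> y)"
  proof (rule sum.cong)
    fix i assume "i \<in> {1..n}"
    then have "1 - q i \<bullet> y \<noteq> 0"
      using pos[of i] by simp
    then show "g i = (y \<bullet> y - q i \<bullet> y) / (1 - q i \<bullet> y) + q i \<bullet> y"
      by (simp add: g_def add_divide_eq_iff algebra_simps power2_eq_square)
  qed simp
  also have "\<dots> = 0"
    by (simp only: sum.distrib sum_y inner_sum_left[symmetric] sum_q) simp
  finally have sum_g: "(\<Sum>i=1..n. g i) = 0" .
  have num: "(q i \<bullet> y)\<^sup>2 \<le> y \<bullet> y" if "i \<in> {1..n}" for i
  proof -
    have "(q i \<bullet> y)\<^sup>2 \<le> (q i \<bullet> q i) * (y \<bullet> y)"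
      by (rule Cauchy_Schwarz_ineq)
    also have "\<dots> \<le> 1 * (y \<bullet> y)"
      using ball[OF that] by (intro mult_right_mono) (auto simp: dot_square_norm power_le_one)
    finally show ?thesis by simp
  qed
  have "g i = 0" if "i \<in> {1..n}" for i
    using sum_g sum_nonneg_eq_0_iff[of "{1..n}" g] num pos that
    by (force simp: g_def intro!: divide_nonneg_pos)
  then have "(q i \<bullet> y)\<^sup>2 = y \<bullet> y" if "i \<in> {1..n}" for i
    using that pos[OF that] by (force simp: g_def)
  then have "q ` {1..n} \<subseteq> {(1 / norm y) *\<^sub>R y, - (1 / norm y) *\<^sub>R y}"
    using extremal_inner_unit_ball[OF ball \<open>y \<noteq> 0\<close>] by blast
  then have "card (q ` {1..n}) \<le> card {(1 / norm y) *\<^sub>R y, - (1 / norm y) *\<^sub>R y}"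
    by (intro card_mono) auto
  also have "\<dots> \<le> 2"
    by (simp add: card_insert_if)
  finally show False
    using n inj by (simp add: card_image)
qed

text \<open>
  A map that preserves the form up to scale and the time axis also preserves the orthogonal
  complement of that axis, on which the form is minus the Euclidean one. After division by the factor
  on the axis, the scale factors cancel.
\<close>

lemma orthogonal_if_fixes_time_axis:
  fixes f :: "real ^ ('d::finite option) \<Rightarrow> real ^ ('d option)"
  assumes f: "linear f" "bij f" and \<alpha>: "\<And>P. line_of (\<alpha> P) = f ` line_of P"
    and a: "0 < a" "\<And>v w. lorentz (f v) (f w) = a * lorentz v w"
    and axis: "f (homogenize 0) = b *\<^sub>R homogenize 0"
  shows "orthogonal_projective_transformation \<alpha>"
proof -
  have b: "b * b = a" "b \<noteq> 0"
    using a(2)[of "homogenize 0" "homogenize 0"] a(1) by (auto simp: axis lorentz_simps)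
  have time: "f v $ None = b * v $ None" for v
  proof -
    have "b * f v $ None = b * (b * v $ None)"
      using a(2)[of v "homogenize 0"] by (simp add: axis lorentz_simps lorentz_time_axis b(1)[symmetric])
    then show ?thesis
      using b(2) by simp
  qed
  define A :: "real ^ 'd \<Rightarrow> real ^ 'd" where "A x = (\<chi> j. f (homogenize x) $ Some j / b)" for x
  have hA: "f (homogenize x) = b *\<^sub>R homogenize (A x)" for x
    using b(2) time[of "homogenize x"]
    by (simp add: vec_eq_iff A_def homogenize_def split: option.split)
  have "A x \<bullet> A y = x \<bullet> y" for x y
  proof -
    have "a * (1 - A x \<bullet> A y) = a * (1 - x \<bullet> y)"
      using a(2)[of "homogenize x" "homogenize y"] by (simp add: hA lorentz_simps b(1)[symmetric])
    then show ?thesis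
      using a(1) by simp
  qed
  moreover have "linear A"
  proof (rule linearI)
    have axis': "f (homogenize 0) $ Some j = 0" for j
      by (simp add: axis)
    show "A (x + y) = A x + A y" for x y
      by (simp add: A_def vec_eq_iff homogenize_add linear_add[OF f(1)] linear_diff[OF f(1)] axis'
          add_divide_distrib)
    show "A (c *\<^sub>R x) = c *\<^sub>R A x" for c x
      by (simp add: A_def vec_eq_iff homogenize_scaleR linear_add[OF f(1)] linear_scale[OF f(1)] axis')
  qed
  ultimately have "orthogonal_transformation A"
    by (simp add: orthogonal_transformation_def)
  moreover have "\<alpha> (chart x) = chart (A x)" for x
  proof -
    have "homogenize (A x) = f ((1 / b) *\<^sub>R homogenize x)"
      using b(2) by (simp add: linear_scale[OF f(1)] hA)
    then show ?thesis
      unfolding chart_eq_iff \<alpha> line_of_chart by (simp add: span_scale span_base)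
  qed
  moreover have "projective_transformation \<alpha>"
    unfolding projective_transformation_def using f \<alpha> by blast
  ultimately show ?thesis
    unfolding orthogonal_projective_transformation_def by blast
qed

text \<open>
  The sum of the normalised image vectors is \<open>n\<close> times the time axis, hence Lorentz orthogonal to
  \<open>f w\<close> for each \<open>w\<close> orthogonal to the preimage \<open>x\<close> of that axis. Choosing \<open>w\<close> in the plane of \<open>x\<close> and
  the time axis gives the identity that \<open>boost_displaces_centroid\<close> needs.
\<close>

lemma recentering_is_orthogonal:
  fixes q :: "nat \<Rightarrow> real ^ 'd::finite"
  assumes n: "n \<ge> 3" and inj: "inj_on q {1..n}" and ball: "\<And>i. i \<in> {1..n} \<Longrightarrow> norm (q i) \<le> 1"
    and sum_q: "(\<Sum>i=1..n. q i) = 0"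
    and \<alpha>: "centering_transformation n q \<alpha>"
  shows "orthogonal_projective_transformation \<alpha>"
proof -
  obtain f where f: "linear f" "bij f" and line: "\<And>P. line_of (\<alpha> P) = f ` line_of P"
    using \<alpha> unfolding centering_transformation_def projective_transformation_def by blast
  have img: "\<alpha> ` (chart ` cball 0 1) = chart ` cball 0 1"
    and sum_\<alpha>: "(\<Sum>i=1..n. affine_coords (\<alpha> (chart (q i)))) = 0"
    using \<alpha> unfolding centering_transformation_def by auto
  have "0 \<le> lorentz (f v) (f v) \<longleftrightarrow> 0 \<le> lorentz v v" for v
    using preserves_ball_iff_preserves_cone[OF f line] img by blast
  then obtain a where a: "0 < a" "\<And>v w. lorentz (f v) (f w) = a * lorentz v w"
    using cone_preserving_conformal[OF f(1) bij_is_surj[OF f(2)]] by blast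
  obtain x where x: "f x = homogenize 0"
    using surjD[OF bij_is_surj[OF f(2)], of "homogenize 0"] by auto
  define c where "c = x $ None"
  have xx: "a * lorentz x x = 1"
    using a(2)[of x x] by (simp add: x)
  then have "0 < lorentz x x"
    using a(1) by (metis zero_less_mult_pos zero_less_one)
  then have c: "c \<noteq> 0"
    using nonneg_lorentz_time_nonzero[of x] unfolding c_def by (cases "x = 0") (auto simp: lorentz_simps)
  then obtain y where y: "x = c *\<^sub>R homogenize y"
    using homogenize_multiple[of x] unfolding c_def by blast
  have "0 < c\<^sup>2 * (1 - y \<bullet> y)"
    using \<open>0 < lorentz x x\<close> by (simp add: y lorentz_simps power2_eq_square mult.assoc)
  then have "y \<bullet> y < 1"
    using c by (simp add: zero_less_mult_iff)
  then have norm_y: "norm y < 1"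
    by (simp add: norm_lt_square)
  define z where "z i = affine_coords (\<alpha> (chart (q i)))" for i
  have z: "(a * c * (1 - q i \<bullet> y)) *\<^sub>R homogenize (z i) = f (homogenize (q i))" if i: "i \<in> {1..n}" for i
  proof -
    have "\<alpha> (chart (q i)) \<in> chart ` cball 0 1"
      using img ball[OF i] by auto
    then have "\<alpha> (chart (q i)) = chart (z i)"
      by (auto simp: z_def)
    then have "line_of (chart (z i)) = f ` span {homogenize (q i)}"
      by (metis line line_of_chart)
    then have "f (homogenize (q i)) \<in> line_of (chart (z i))"
      by (simp add: span_base)
    then obtain t where t: "f (homogenize (q i)) = t *\<^sub>R homogenize (z i)"
      by (auto simp: line_of_chart span_singleton)
    have "t = lorentz (f (homogenize (q i))) (f x)"
      by (simp add: t x lorentz_simps lorentz_time_axis)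
    also have "\<dots> = a * c * (1 - q i \<bullet> y)"
      by (simp add: a(2) y lorentz_simps)
    finally show ?thesis
      using t by simp
  qed
  \<comment> \<open>This is \<open>(y \<bullet> y, y)\<close>, which is orthogonal to \<open>(1, y)\<close>.\<close>
  define w where "w = homogenize y - (1 - y \<bullet> y) *\<^sub>R homogenize 0"
  have summand: "(y \<bullet> y - q i \<bullet> y) / (1 - q i \<bullet> y) = c * lorentz (homogenize (z i)) (f w)"
    if i: "i \<in> {1..n}" for i
  proof -
    have pos: "0 < 1 - q i \<bullet> y"
      using inner_less_one[OF ball[OF i] norm_y] by simp
    have "a * c * (1 - q i \<bullet> y) * lorentz (homogenize (z i)) (f w) = a * lorentz (homogenize (q i)) w"
      by (simp add: a(2)[symmetric] z[OF i, symmetric] lorentz_simps)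
    also have "\<dots> = a * (y \<bullet> y - q i \<bullet> y)"
      by (simp add: w_def lorentz_simps)
    finally have "a * ((c * lorentz (homogenize (z i)) (f w)) * (1 - q i \<bullet> y)) = a * (y \<bullet> y - q i \<bullet> y)"
      by (simp only: mult_ac)
    then have "(c * lorentz (homogenize (z i)) (f w)) * (1 - q i \<bullet> y) = y \<bullet> y - q i \<bullet> y"
      using a(1) by simp
    then show ?thesis
      using pos by (simp add: divide_eq_eq)
  qed
  have "(\<Sum>i=1..n. homogenize (z i)) = real n *\<^sub>R homogenize 0"
    unfolding vec_eq_iff
  proof
    fix i
    show "(\<Sum>i=1..n. homogenize (z i)) $ i = (real n *\<^sub>R homogenize 0) $ i"
      using arg_cong[OF sum_\<alpha>, of "\<lambda>v. v $ the i"] by (cases i) (simp_all add: z_def)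
  qed
  then have sum_z: "(\<Sum>i=1..n. homogenize (z i)) = real n *\<^sub>R f x"
    by (simp only: x)
  have "linear (\<lambda>v. lorentz v (f w))"
    using bilinear_lorentz unfolding bilinear_def by blast
  from linear_sum[OF this, of "\<lambda>i. homogenize (z i)" "{1..n}"]
  have "(\<Sum>i=1..n. lorentz (homogenize (z i)) (f w)) = real n * lorentz (f x) (f w)"
    unfolding sum_z by (simp add: lorentz_simps)
  also have "lorentz (f x) (f w) = 0"
    by (simp add: a(2) y w_def lorentz_simps)
  finally have "(\<Sum>i=1..n. (y \<bullet> y - q i \<bullet> y) / (1 - q i \<bullet> y)) = 0"
    by (simp add: summand sum_distrib_left[symmetric])
  then have "y = 0"
    using boost_displaces_centroid[OF n inj ball norm_y sum_q] by blast
  then have "f (homogenize 0) = (1 / c) *\<^sub>R f x"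
    using c by (simp add: y linear_scale[OF f(1)])
  then have "f (homogenize 0) = (1 / c) *\<^sub>R homogenize 0"
    by (simp only: x)
  then show ?thesis
    using orthogonal_if_fixes_time_axis[OF f line a] by blast
qed

lemma projective_transformation_quotient:
  assumes "projective_transformation \<phi>" "projective_transformation \<psi>"
  obtains \<alpha> where "projective_transformation \<alpha>" "\<psi> = \<alpha> \<circ> \<phi>" "bij \<phi>"
proof -
  obtain f where f: "linear f" "bij f" "\<And>P. line_of (\<phi> P) = f ` line_of P"
    using assms(1) unfolding projective_transformation_def by blast
  obtain g where g: "linear g" "bij g" "\<And>P. line_of (\<psi> P) = g ` line_of P"
    using assms(2) unfolding projective_transformation_def by blast
  define h where "h = g \<circ> inv f"
  have h: "linear h" "bij h"
    unfolding h_def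
    using linear_compose[OF inj_linear_imp_inv_linear[OF f(1) bij_is_inj[OF f(2)]] g(1)]
      bij_comp[OF bij_imp_bij_inv[OF f(2)] g(2)]
    by auto
  have line: "line_of (projective_map h P) = h ` line_of P" for P
    using line_of_projective_map[OF h(1) bij_is_inj[OF h(2)]] .
  have "line_of (projective_map h (\<phi> P)) = line_of (\<psi> P)" for P
  proof -
    have "h ` f ` line_of P = g ` line_of P"
      using bij_is_inj[OF f(2)] by (simp add: h_def image_image)
    then show ?thesis
      by (simp only: line f(3) g(3))
  qed
  then have "\<psi> = projective_map h \<circ> \<phi>"
    by (simp add: fun_eq_iff line_of_inject)
  moreover have "projective_transformation (projective_map h)"
    unfolding projective_transformation_def using h line by blast
  ultimately show thesis
    using that bij_if_line_of_image[OF f] by blast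
qed

lemma centering_transformation_unique:
  fixes p :: "nat \<Rightarrow> real ^ 'd::finite"
  assumes n: "n \<ge> 3" and inj: "inj_on p {1..n}" and ball: "\<forall>i\<in>{1..n}. p i \<in> cball 0 1"
    and \<phi>: "centering_transformation n p \<phi>" and \<psi>: "centering_transformation n p \<psi>"
  shows "\<exists>\<alpha>. orthogonal_projective_transformation \<alpha> \<and> \<psi> = \<alpha> \<circ> \<phi>"
proof -
  obtain \<alpha> where \<alpha>: "projective_transformation \<alpha>" "\<psi> = \<alpha> \<circ> \<phi>" and "bij \<phi>"
    using projective_transformation_quotient \<phi> \<psi> unfolding centering_transformation_def by metis
  define q where "q i = affine_coords (\<phi> (chart (p i)))" for i
  have q: "chart (q i) = \<phi> (chart (p i)) \<and> norm (q i) \<le> 1" if "i \<in> {1..n}" for i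
  proof -
    have "\<phi> (chart (p i)) \<in> chart ` cball 0 1"
      using \<phi> ball that unfolding centering_transformation_def by blast
    then show ?thesis
      by (auto simp: q_def)
  qed
  have "inj_on q {1..n}"
  proof (rule inj_onI)
    fix i j assume ij: "i \<in> {1..n}" "j \<in> {1..n}" "q i = q j"
    then have "\<phi> (chart (p i)) = \<phi> (chart (p j))"
      using q by metis
    then have "p i = p j"
      using \<open>bij \<phi>\<close> inj_chart by (metis bij_is_inj injD)
    then show "i = j"
      using inj ij by (auto dest: inj_onD)
  qed
  moreover have "(\<Sum>i=1..n. q i) = 0"
    using \<phi> by (simp add: centering_transformation_def q_def)
  moreover have "centering_transformation n q \<alpha>"
    unfolding centering_transformation_def
  proof (intro conjI)
    show "\<alpha> ` (chart ` cball 0 1) = chart ` cball 0 1"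
      using \<phi> \<psi> unfolding centering_transformation_def \<alpha>(2) by (metis image_comp)
    show "(\<Sum>i=1..n. affine_coords (\<alpha> (chart (q i)))) = 0"
      using \<psi> q by (simp add: centering_transformation_def \<alpha>(2))
  qed (rule \<alpha>(1))
  ultimately show ?thesis
    using recentering_is_orthogonal[OF n] q \<alpha>(2) by blast
qed

theorem theorem5:
  fixes p :: "nat \<Rightarrow> real ^ 'd" and n :: nat
  assumes "n \<ge> 3"
    and "inj_on p {1..n}"
    and "\<forall>i\<in>{1..n}. p i \<in> cball 0 1"
  shows "(\<exists>\<phi>. centering_transformation n p \<phi>) \<and>
    (\<forall>\<phi> \<psi>. centering_transformation n p \<phi> \<and> centering_transformation n p \<psi> \<longrightarrow>
      (\<exists>\<alpha>. orthogonal_projective_transformation \<alpha> \<and> \<psi> = \<alpha> \<circ> \<phi>))"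
  using centering_transformation_exists[OF assms] centering_transformation_unique[OF assms]
  by blast

end
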